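(* (1) Let $G$ be the dihedral group of type $I_2(2n)$ (order $4n$). Let $H_i,H_j$ be a pair of reflection hyperplanes such that $R(i,j)=\emptyset$ and $s_is_j\ne s_js_i$. Suppose $s_is_js_i=s_k$. In the algebra $\hat B_G(\Upsilon)$, if $\Upsilon$ satisfies $\mu_i+\mu_{[n+i]}-\tau_k\neq0$ and $\mu_i-\mu_{[n+i]}-\tau_k\ne0$, then for any irreducible representation $(V,\rho)$ of $\hat B_G(\Upsilon)$ we have $\rho(e_i)\rho(e_j)=\rho(e_j)\rho(e_i)=0$. (2) Let $G$ be the dihedral group of type $I_2(2n)$. Let $H_i,H_j$ be a pair of reflection hyperplanes such that $R(i,j)=\emptyset$ and $s_is_j=s_js_i$. In the algebra $\hat B_G(\Upsilon)$, if $\Upsilon$ satisfies $\tau_0(\mu_1+\mu_0)\ne0$, $\tau_0(\mu_1-\mu_0)\neq0$, $\mu_2+\mu_{[n+2]}-\tau_4\neq0$ and $\mu_2-\mu_{[n+2]}-\tau_4\ne0$, then for any irreducible representation $(V,\rho)$ of $\hat B_G(\Upsilon)$ we have $\rho(e_i)\rho(e_j)=\rho(e_j)\rho(e_i)=0$.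
   Context: $G$ acts on $\mathbb{R}^2$ (complexified); for $0\le i\le 2n-1$, $s_i$ is the reflection in the line $H_i$ through the origin at angle $\pi i/(2n)$ to the $x$-axis; indices are read modulo $2n$ and $[k]$ is the residue of $k$ mod $2n$ in $\{0,\dots,2n-1\}$. $R=\{s_0,\dots,s_{2n-1}\}$ and $R(i,j)=\{s\in R:s(H_j)=H_i\}$. $\Upsilon$: complex numbers $\mu_i=\mu_{s_i}$ and $\tau_i$ depending only on the parity of $i$. $\hat B_G(\Upsilon)$ is the unital associative $\mathbb{C}$-algebra generated by $\{\bar w\}_{w\in G}\cup\{e_i\}_{0\le i\le2n-1}$ with relations: $\bar w_1\bar w_2=\bar w_3$ if $w_1w_2=w_3$ in $G$ (and $\bar1$ is the unit); $\bar s_ie_i=e_i\bar s_i=e_i$; $e_i^2=\tau_ie_i$; $\bar we_j=e_i\bar w$ if $w(H_j)=H_i$; and for $i\neq j$: $e_ie_j=e_je_i$ if $H_i,H_j$ are the only reflection lines containing $H_i\cap H_j$; $e_ie_j=\big(\sum_{s\in R(i,j)}\mu_s\bar s\big)e_j$ if some other reflection line contains $H_i\cap H_j$ and $R(i,j)\neq\emptyset$; and $e_ie_j=e_je_i$ if some other reflection line contains $H_i\cap H_j$ and $R(i,j)=\emptyset$. *)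

theory Defs
  imports
    "HOL-Analysis.Analysis"
    "HOL-Library.Poly_Mapping"
    "HOL-Algebra.Bij"
    "HOL-Algebra.Generated_Groups"
    "HOL-Algebra.Module"
    "HOL-Algebra.QuotRing"
begin

text \<open>
  The complexified lines are determined by the real ones, and a real map carries one complexified
  line to another (or one such intersection into a line) iff it does so over the reals.
  Everything is therefore stated on \<open>real^2\<close>.
\<close>

definition refl_line :: "nat \<Rightarrow> nat \<Rightarrow> (real^2) set" where
  "refl_line n i = span {vector [cos (pi * real i / (2 * real n)), sin (pi * real i / (2 * real n))]}"

definition line_normal :: "nat \<Rightarrow> nat \<Rightarrow> real^2" where
  "line_normal n i = vector [- sin (pi * real i / (2 * real n)), cos (pi * real i / (2 * real n))]"

definition dih_refl :: "nat \<Rightarrow> nat \<Rightarrow> real^2 \<Rightarrow> real^2" where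
  "dih_refl n i x = x - (2 * (x \<bullet> line_normal n i)) *\<^sub>R line_normal n i"

definition reflections :: "nat \<Rightarrow> (real^2 \<Rightarrow> real^2) set" where
  "reflections n = dih_refl n ` {0..<2 * n}"

definition dihedral :: "nat \<Rightarrow> (real^2 \<Rightarrow> real^2) set" where
  "dihedral n = generate (BijGroup UNIV) (reflections n)"

definition R_set :: "nat \<Rightarrow> nat \<Rightarrow> nat \<Rightarrow> (real^2 \<Rightarrow> real^2) set" where
  "R_set n i j = {s \<in> reflections n. s ` refl_line n j = refl_line n i}"

definition only_two_lines :: "nat \<Rightarrow> nat \<Rightarrow> nat \<Rightarrow> bool" where
  "only_two_lines n i j \<longleftrightarrow>
     (\<forall>k<2 * n. refl_line n i \<inter> refl_line n j \<subseteq> refl_line n k \<longrightarrow>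
        refl_line n k = refl_line n i \<or> refl_line n k = refl_line n j)"

text \<open>
  Words form the free monoid under concatenation, so \<open>'g list \<Rightarrow>\<^sub>0 complex\<close> with the convolution
  product of \<^theory>\<open>HOL-Library.Poly_Mapping\<close> is the free associative algebra on \<open>'g\<close>.
\<close>

instantiation list :: (type) monoid_add
begin

definition zero_list :: "'a list" where "zero_list = []"

definition plus_list :: "'a list \<Rightarrow> 'a list \<Rightarrow> 'a list" where "plus_list = (@)"

instance
  by standard (simp_all add: zero_list_def plus_list_def)

end

definition free_algebra :: "'g set \<Rightarrow> (complex, 'g list \<Rightarrow>\<^sub>0 complex) module" where
  "free_algebra X =
    \<lparr>carrier = {p. Poly_Mapping.keys p \<subseteq> lists X}, monoid.mult = (*), one = 1, zero = 0, add = (+),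
     smult = (\<lambda>z p. Poly_Mapping.single [] z * p)\<rparr>"

lemma ring_free_algebra: "ring (free_algebra X)"
proof (rule ringI)
  show "abelian_group (free_algebra X)"
  proof (rule abelian_groupI)
    fix p assume "p \<in> carrier (free_algebra X)"
    then show "\<exists>q\<in>carrier (free_algebra X). q \<oplus>\<^bsub>free_algebra X\<^esub> p = \<zero>\<^bsub>free_algebra X\<^esub>"
      by (intro bexI[of _ "- p"]) (auto simp: free_algebra_def in_keys_iff)
  qed (use keys_add in \<open>fastforce simp: free_algebra_def algebra_simps\<close>)+
  have "Poly_Mapping.keys (p * q) \<subseteq> lists X"
    if "Poly_Mapping.keys p \<subseteq> lists X" "Poly_Mapping.keys q \<subseteq> lists X" for p q :: "'a list \<Rightarrow>\<^sub>0 complex"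
  proof
    fix w assume "w \<in> Poly_Mapping.keys (p * q)"
    then obtain u v where "w = u + v" "u \<in> Poly_Mapping.keys p" "v \<in> Poly_Mapping.keys q"
      using keys_mult[of p q] by auto
    with that show "w \<in> lists X"
      by (auto simp: plus_list_def)
  qed
  moreover have "Poly_Mapping.keys (1 :: 'a list \<Rightarrow>\<^sub>0 complex) \<subseteq> lists X"
    by (simp add: zero_list_def)
  ultimately show "Group.monoid (free_algebra X)"
    by (intro monoidI) (auto simp: free_algebra_def mult.assoc)
qed (auto simp: free_algebra_def algebra_simps)

text \<open>The ring structure is the library's quotient ring; only the scalar action is added.\<close>

definition quotient_algebra :: "('k, 'a) module \<Rightarrow> 'a set \<Rightarrow> ('k, 'a set) module" where
  "quotient_algebra A I =
     ring.extend (A Quot I) (module.fields (\<lambda>z C. \<Union>a\<in>C. I +>\<^bsub>A\<^esub> (z \<odot>\<^bsub>A\<^esub> a)))"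

datatype gen = Gen_w "real^2 \<Rightarrow> real^2" | Gen_e nat

definition gens :: "nat \<Rightarrow> gen set" where
  "gens n = Gen_w ` dihedral n \<union> Gen_e ` {0..<2 * n}"

type_synonym free_elt = "gen list \<Rightarrow>\<^sub>0 complex"

definition fw :: "(real^2 \<Rightarrow> real^2) \<Rightarrow> free_elt" where
  "fw w = Poly_Mapping.single [Gen_w w] 1"

definition fe :: "nat \<Rightarrow> free_elt" where
  "fe i = Poly_Mapping.single [Gen_e i] 1"

text \<open>
  The parameters are \<open>\<mu> s\<close> for a reflection \<open>s\<close> (so \<open>\<mu>\<^sub>i\<close> is \<open>\<mu> (dih_refl n i)\<close>) and \<open>\<tau> i\<close> for
  \<open>i < 2 * n\<close>. The constant \<open>c\<close> of the free algebra is \<open>Poly_Mapping.single [] c\<close>.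
\<close>

inductive brauer_rel ::
  "nat \<Rightarrow> ((real^2 \<Rightarrow> real^2) \<Rightarrow> complex) \<Rightarrow> (nat \<Rightarrow> complex) \<Rightarrow> free_elt \<Rightarrow> free_elt \<Rightarrow> bool"
  for n \<mu> \<tau>
where
  rel_unit: "brauer_rel n \<mu> \<tau> (fw id) 1"
| rel_group: "brauer_rel n \<mu> \<tau> (fw w1 * fw w2) (fw w3)"
    if "w1 \<in> dihedral n" "w2 \<in> dihedral n" "w3 \<in> dihedral n" "w1 \<circ> w2 = w3"
| rel_refl_left: "brauer_rel n \<mu> \<tau> (fw (dih_refl n i) * fe i) (fe i)" if "i < 2 * n"
| rel_refl_right: "brauer_rel n \<mu> \<tau> (fe i * fw (dih_refl n i)) (fe i)" if "i < 2 * n"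
| rel_square: "brauer_rel n \<mu> \<tau> (fe i * fe i) (Poly_Mapping.single [] (\<tau> i) * fe i)" if "i < 2 * n"
| rel_conj: "brauer_rel n \<mu> \<tau> (fw w * fe j) (fe i * fw w)"
    if "w \<in> dihedral n" "i < 2 * n" "j < 2 * n" "w ` refl_line n j = refl_line n i"
| rel_comm_two: "brauer_rel n \<mu> \<tau> (fe i * fe j) (fe j * fe i)"
    if "i < 2 * n" "j < 2 * n" "i \<noteq> j" "only_two_lines n i j"
| rel_reduce: "brauer_rel n \<mu> \<tau> (fe i * fe j)
      ((\<Sum>s\<in>R_set n i j. Poly_Mapping.single [] (\<mu> s) * fw s) * fe j)"
    if "i < 2 * n" "j < 2 * n" "i \<noteq> j" "\<not> only_two_lines n i j" "R_set n i j \<noteq> {}"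
| rel_comm_empty: "brauer_rel n \<mu> \<tau> (fe i * fe j) (fe j * fe i)"
    if "i < 2 * n" "j < 2 * n" "i \<noteq> j" "\<not> only_two_lines n i j" "R_set n i j = {}"

text \<open>
  Ideals of a \<open>ring\<close> are two-sided, and since the ring contains the constants they are closed
  under scalars.
\<close>

definition brauer_ideal ::
  "nat \<Rightarrow> ((real^2 \<Rightarrow> real^2) \<Rightarrow> complex) \<Rightarrow> (nat \<Rightarrow> complex) \<Rightarrow> free_elt set" where
  "brauer_ideal n \<mu> \<tau> = genideal (free_algebra (gens n)) {x - y | x y. brauer_rel n \<mu> \<tau> x y}"

definition brauer_algebra ::
  "nat \<Rightarrow> ((real^2 \<Rightarrow> real^2) \<Rightarrow> complex) \<Rightarrow> (nat \<Rightarrow> complex) \<Rightarrow> (complex, free_elt set) module" where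
  "brauer_algebra n \<mu> \<tau> = quotient_algebra (free_algebra (gens n)) (brauer_ideal n \<mu> \<tau>)"

definition e_elt ::
  "nat \<Rightarrow> ((real^2 \<Rightarrow> real^2) \<Rightarrow> complex) \<Rightarrow> (nat \<Rightarrow> complex) \<Rightarrow> nat \<Rightarrow> free_elt set" where
  "e_elt n \<mu> \<tau> i = brauer_ideal n \<mu> \<tau> +>\<^bsub>free_algebra (gens n)\<^esub> fe i"

definition End_ring :: "(complex \<Rightarrow> 'v \<Rightarrow> 'v::ab_group_add) \<Rightarrow> ('v \<Rightarrow> 'v) ring" where
  "End_ring scl =
    \<lparr>carrier = {f. Vector_Spaces.linear scl scl f}, monoid.mult = (\<circ>), one = id,
     zero = (\<lambda>_. 0), add = (\<lambda>f g v. f v + g v)\<rparr>"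

definition representation ::
  "(complex, 'a) module \<Rightarrow> (complex \<Rightarrow> 'v \<Rightarrow> 'v::ab_group_add) \<Rightarrow> ('a \<Rightarrow> 'v \<Rightarrow> 'v) \<Rightarrow> bool" where
  "representation B scl \<rho> \<longleftrightarrow>
     vector_space scl \<and> \<rho> \<in> ring_hom B (End_ring scl) \<and>
     (\<forall>z. \<forall>b\<in>carrier B. \<rho> (z \<odot>\<^bsub>B\<^esub> b) = (\<lambda>v. scl z (\<rho> b v)))"

definition irreducible_representation ::
  "(complex, 'a) module \<Rightarrow> (complex \<Rightarrow> 'v \<Rightarrow> 'v::ab_group_add) \<Rightarrow> ('a \<Rightarrow> 'v \<Rightarrow> 'v) \<Rightarrow> bool" where
  "irreducible_representation B scl \<rho> \<longleftrightarrow>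
     representation B scl \<rho> \<and> (UNIV :: 'v set) \<noteq> {0} \<and>
     (\<forall>W. module.subspace scl W \<and> (\<forall>b\<in>carrier B. \<rho> b ` W \<subseteq> W) \<longrightarrow> W = {0} \<or> W = UNIV)"

end

(* The products already vanish in the algebra, before any representation is applied. Recall that
   R(i,j) is empty iff i + j is odd.

   If s_i and s_j do not commute, put X = e_i e_j = e_j e_i. Since s_i X = X and s_i e_j = e_k s_i,
   also X = e_k e_i, and computing e_j e_k e_i both as e_j X and by the reduction of e_j e_k gives
   (mu_i - tau_k) X + mu_(n+i) s_(n+i) X = 0. The involution s_(n+i) turns this into a symmetric
   2 x 2 system with determinant (mu_i - tau_k)^2 - mu_(n+i)^2, so X = 0.

   If they commute, then n is odd and j = i + n modulo 2n. The element e_1 e_0 is fixed by s_0 and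
   s_1, hence by every s_i, so the equation above becomes (mu_1 + mu_0 - tau_0) e_1 e_0 = 0. Thus
   e_i e_(i+1) = 0 for all i, and reducing e_(i+1) e_(i+n) in 0 = e_(i+1) e_(i+n) e_i gives a
   symmetric system with determinant mu_0^2 - mu_1^2 for e_(i+n) e_i. *)

theory Submission
  imports Defs "HOL-Number_Theory.Cong"
begin

section \<open>Reflections and lines in the plane\<close>

definition direction :: "real \<Rightarrow> real^2" where
  "direction \<alpha> = vector [cos \<alpha>, sin \<alpha>]"

lemma direction_component [simp]: "direction \<alpha> $ 1 = cos \<alpha>" "direction \<alpha> $ 2 = sin \<alpha>"
  by (simp_all add: direction_def)

text \<open>The reflection in the line at angle \<alpha>/2. Taking twice the angle of the mirror as
  parameter keeps the composition rules free of fractions; s_i gets the parameter pi i / n.\<close>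

definition reflect :: "real \<Rightarrow> real^2 \<Rightarrow> real^2" where
  "reflect \<alpha> x = vector [cos \<alpha> * x $ 1 + sin \<alpha> * x $ 2, sin \<alpha> * x $ 1 - cos \<alpha> * x $ 2]"

lemma reflect_component [simp]:
  "reflect \<alpha> x $ 1 = cos \<alpha> * x $ 1 + sin \<alpha> * x $ 2"
  "reflect \<alpha> x $ 2 = sin \<alpha> * x $ 1 - cos \<alpha> * x $ 2"
  by (simp_all add: reflect_def)

lemma linear_reflect: "linear (reflect \<alpha>)"
  by (rule linearI) (simp_all add: vec_eq_iff forall_2 algebra_simps)

lemma reflect_direction: "reflect \<alpha> (direction \<beta>) = direction (\<alpha> - \<beta>)"
  by (simp add: vec_eq_iff forall_2 cos_diff sin_diff)

lemma reflect_reflect [simp]: "reflect \<alpha> (reflect \<alpha> x) = x"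
proof -
  have "reflect \<alpha> (reflect \<alpha> x) $ 1 = x $ 1 * ((sin \<alpha>)\<^sup>2 + (cos \<alpha>)\<^sup>2)"
    unfolding reflect_component power2_eq_square by (simp only: algebra_simps)
  moreover have "reflect \<alpha> (reflect \<alpha> x) $ 2 = x $ 2 * ((sin \<alpha>)\<^sup>2 + (cos \<alpha>)\<^sup>2)"
    unfolding reflect_component power2_eq_square by (simp only: algebra_simps)
  ultimately show ?thesis
    by (simp add: vec_eq_iff forall_2)
qed

lemma reflect_conj: "reflect \<alpha> \<circ> reflect \<beta> \<circ> reflect \<alpha> = reflect (2 * \<alpha> - \<beta>)"
proof -
  \<comment> \<open>Split as (\<alpha> - \<beta>) + \<alpha>, the angle expands into the same cubic
    polynomials in the sines and cosines of \<alpha> and \<beta> as the threefold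
    composition.\<close>
  define \<gamma> where "\<gamma> = 2 * \<alpha> - \<beta>"
  have \<gamma>: "\<gamma> = (\<alpha> - \<beta>) + \<alpha>" by (simp add: \<gamma>_def)
  have "reflect \<alpha> (reflect \<beta> (reflect \<alpha> x)) = reflect \<gamma> x" for x
    unfolding vec_eq_iff forall_2 reflect_component \<gamma> cos_add sin_add cos_diff sin_diff
    by (simp add: algebra_simps)
  then show ?thesis by (simp add: fun_eq_iff \<gamma>_def)
qed

lemma reflect_eq_iff: "reflect \<alpha> = reflect \<beta> \<longleftrightarrow> (\<exists>m::int. \<alpha> = \<beta> + 2 * pi * m)"
proof
  assume eq: "reflect \<alpha> = reflect \<beta>"
  \<comment> \<open>The unit vector on the x-axis is sent to the one at angle \<alpha>, so the map
    determines \<alpha> up to full turns.\<close>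
  have "reflect \<alpha> (direction 0) = reflect \<beta> (direction 0)" by (simp add: eq)
  then have "direction \<alpha> = direction \<beta>" by (simp add: reflect_direction)
  then have "sin \<alpha> = sin \<beta> \<and> cos \<alpha> = cos \<beta>" by (simp add: vec_eq_iff forall_2)
  then show "\<exists>m::int. \<alpha> = \<beta> + 2 * pi * m" by (metis sin_cos_eq_iff)
next
  assume "\<exists>m::int. \<alpha> = \<beta> + 2 * pi * m"
  then have "sin \<alpha> = sin \<beta> \<and> cos \<alpha> = cos \<beta>" by (metis sin_cos_eq_iff)
  then show "reflect \<alpha> = reflect \<beta>" by (simp add: fun_eq_iff vec_eq_iff forall_2)
qed

section \<open>The dihedral group\<close>

lemma dih_refl_reflect: "dih_refl n i = reflect (pi * real i / real n)"
proof (rule ext)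
  fix x :: "real^2"
  define \<theta> where "\<theta> = pi * real i / (2 * real n)"
  have normal: "line_normal n i = vector [- sin \<theta>, cos \<theta>]"
    by (simp add: line_normal_def \<theta>_def)
  have "dih_refl n i x $ 1 = reflect (2 * \<theta>) x $ 1"
    unfolding reflect_component cos_double_sin sin_double
    by (simp add: dih_refl_def normal inner_vec_def sum_2 power2_eq_square algebra_simps)
  moreover have "dih_refl n i x $ 2 = reflect (2 * \<theta>) x $ 2"
    unfolding reflect_component cos_double_cos sin_double
    by (simp add: dih_refl_def normal inner_vec_def sum_2 power2_eq_square algebra_simps)
  ultimately show "dih_refl n i x = reflect (pi * real i / real n) x"
    by (simp add: vec_eq_iff forall_2 \<theta>_def)
qed

section \<open>Lines through the origin and their incidence with reflections\<close>

lemma mem_span_direction_iff: "v \<in> span {direction \<alpha>} \<longleftrightarrow> v $ 1 * sin \<alpha> = v $ 2 * cos \<alpha>"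
proof
  assume "v \<in> span {direction \<alpha>}"
  then obtain c where "v = c *\<^sub>R direction \<alpha>" by (auto simp: span_singleton)
  then show "v $ 1 * sin \<alpha> = v $ 2 * cos \<alpha>" by simp
next
  assume h: "v $ 1 * sin \<alpha> = v $ 2 * cos \<alpha>"
  \<comment> \<open>The direction has unit length, so the coefficient of \<open>v\<close> along it
    must be their inner product.\<close>
  define c where "c = v $ 1 * cos \<alpha> + v $ 2 * sin \<alpha>"
  have "c * cos \<alpha> = v $ 1 * (cos \<alpha>)\<^sup>2 + (v $ 2 * cos \<alpha>) * sin \<alpha>"
    by (simp add: c_def power2_eq_square algebra_simps)
  also have "\<dots> = v $ 1 * ((cos \<alpha>)\<^sup>2 + (sin \<alpha>)\<^sup>2)"
    by (simp only: h[symmetric] power2_eq_square distrib_left mult.assoc)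
  finally have 1: "c * cos \<alpha> = v $ 1" by simp
  have "c * sin \<alpha> = (v $ 1 * sin \<alpha>) * cos \<alpha> + v $ 2 * (sin \<alpha>)\<^sup>2"
    by (simp add: c_def power2_eq_square algebra_simps)
  also have "\<dots> = v $ 2 * ((cos \<alpha>)\<^sup>2 + (sin \<alpha>)\<^sup>2)"
    by (simp only: h power2_eq_square distrib_left mult.assoc)
  finally have 2: "c * sin \<alpha> = v $ 2" by simp
  have "v = c *\<^sub>R direction \<alpha>" using 1 2 by (simp add: vec_eq_iff forall_2)
  then show "v \<in> span {direction \<alpha>}" by (simp add: span_base span_scale)
qed

text \<open>Up to sign, sin(\<alpha> - \<beta>) is the determinant of the two unit vectors, so it
  vanishes exactly when they are linearly dependent.\<close>

lemma span_direction_eq_iff: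
  "span {direction \<alpha>} = span {direction \<beta>} \<longleftrightarrow> sin (\<alpha> - \<beta>) = 0"
proof
  assume "span {direction \<alpha>} = span {direction \<beta>}"
  then have "direction \<alpha> \<in> span {direction \<beta>}" using span_base by blast
  then show "sin (\<alpha> - \<beta>) = 0" by (simp add: mem_span_direction_iff sin_diff mult.commute)
next
  assume "sin (\<alpha> - \<beta>) = 0"
  then have eq: "sin \<alpha> * cos \<beta> = cos \<alpha> * sin \<beta>" by (simp add: sin_diff)
  have "direction \<alpha> \<in> span {direction \<beta>}" "direction \<beta> \<in> span {direction \<alpha>}"
    using eq by (simp_all add: mem_span_direction_iff mult.commute)
  then show "span {direction \<alpha>} = span {direction \<beta>}"
    by (intro subset_antisym span_minimal subspace_span) auto
qed

text \<open>The two line equations form a homogeneous linear system with determinant sin(\<alpha> -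
  \<beta>) up to sign; each coordinate is isolated as in Cramer's rule.\<close>

lemma span_direction_Int:
  assumes "sin (\<alpha> - \<beta>) \<noteq> 0"
  shows "span {direction \<alpha>} \<inter> span {direction \<beta>} = {0}"
proof -
  have "v = 0" if "v $ 1 * sin \<alpha> = v $ 2 * cos \<alpha>" "v $ 1 * sin \<beta> = v $ 2 * cos \<beta>" for v :: "real^2"
  proof -
    have "v $ 1 * sin (\<alpha> - \<beta>) = (v $ 1 * sin \<alpha>) * cos \<beta> - (v $ 1 * sin \<beta>) * cos \<alpha>"
      by (simp add: sin_diff algebra_simps)
    also have "\<dots> = 0" unfolding that by simp
    finally have 1: "v $ 1 = 0" using assms by simp
    have "v $ 2 * sin (\<alpha> - \<beta>) = sin \<alpha> * (v $ 2 * cos \<beta>) - sin \<beta> * (v $ 2 * cos \<alpha>)"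
      by (simp add: sin_diff algebra_simps)
    also have "\<dots> = 0" unfolding that[symmetric] by simp
    finally have "v $ 2 = 0" using assms by simp
    with 1 show ?thesis by (simp add: vec_eq_iff forall_2)
  qed
  then show ?thesis by (auto simp: mem_span_direction_iff span_zero)
qed

lemma refl_line_direction: "refl_line n i = span {direction (pi * real i / (2 * real n))}"
  by (simp add: refl_line_def direction_def)

lemma sin_pi_quotient_eq_0_iff:
  assumes "n > 0"
  shows "sin (pi * real_of_int m / (2 * real n)) = 0 \<longleftrightarrow> 2 * int n dvd m"
proof -
  have "pi * real_of_int m / (2 * real n) = of_int k * pi \<longleftrightarrow> m = 2 * int n * k" for k
  proof -
    have "pi * real_of_int m / (2 * real n) = of_int k * pi
        \<longleftrightarrow> real_of_int m = real_of_int (2 * int n * k)"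
      using assms by (auto simp: field_simps)
    then show ?thesis using of_int_eq_iff by blast
  qed
  then show ?thesis by (auto simp: sin_zero_iff_int2 dvd_def)
qed

text \<open>Reflecting in H_a sends the angle of H_j to twice that of H_a minus that of H_j, and a
  line returns to itself after a half turn, which is an index shift by 2n. Writing the congruence
  with a sum avoids subtraction on naturals; later facts keep this form.\<close>

lemma dih_refl_image_refl_line_iff:
  assumes "n > 0"
  shows "dih_refl n a ` refl_line n j = refl_line n i \<longleftrightarrow> [i + j = 2 * a] (mod 2 * n)"
proof -
  have "dih_refl n a ` refl_line n j
      = span {direction (pi * real a / real n - pi * real j / (2 * real n))}"
    unfolding refl_line_direction dih_refl_reflect
    by (simp add: linear_span_image[OF linear_reflect, symmetric] reflect_direction)
  moreover have "pi * real a / real n - pi * real j / (2 * real n) - pi * real i / (2 * real n)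
      = pi * real_of_int (2 * int a - int j - int i) / (2 * real n)"
    using assms by (simp add: field_simps)
  ultimately have "dih_refl n a ` refl_line n j = refl_line n i
      \<longleftrightarrow> 2 * int n dvd (2 * int a - int j - int i)"
    by (simp only: refl_line_direction span_direction_eq_iff sin_pi_quotient_eq_0_iff[OF assms])
  also have "\<dots> \<longleftrightarrow> [i + j = 2 * a] (mod 2 * n)"
    by (simp add: cong_int_iff[symmetric] cong_iff_dvd_diff dvd_diff_commute algebra_simps)
  finally show ?thesis .
qed

lemma dih_refl_eq_iff:
  assumes "n > 0"
  shows "dih_refl n i = dih_refl n j \<longleftrightarrow> [i = j] (mod 2 * n)"
proof -
  have "pi * real i / real n = pi * real j / real n + 2 * pi * real_of_int m
      \<longleftrightarrow> int i - int j = 2 * int n * m" for m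
  proof -
    have "pi * real i / real n = pi * real j / real n + 2 * pi * real_of_int m
      \<longleftrightarrow> pi * real_of_int (int i - int j) = pi * real_of_int (2 * int n * m)"
      using assms by (auto simp: field_simps)
    then show ?thesis unfolding mult_cancel_left of_int_eq_iff using pi_neq_zero by simp
  qed
  then have "dih_refl n i = dih_refl n j \<longleftrightarrow> 2 * int n dvd int i - int j"
    by (simp add: dih_refl_reflect reflect_eq_iff dvd_def)
  then show ?thesis
    by (simp add: cong_int_iff[symmetric] cong_iff_dvd_diff)
qed

lemma refl_line_eq_iff:
  assumes "n > 0"
  shows "refl_line n i = refl_line n j \<longleftrightarrow> [i = j] (mod 2 * n)"
proof -
  have "pi * real i / (2 * real n) - pi * real j / (2 * real n)
      = pi * real_of_int (int i - int j) / (2 * real n)"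
    by (simp add: diff_divide_distrib right_diff_distrib)
  then have "refl_line n i = refl_line n j \<longleftrightarrow> 2 * int n dvd int i - int j"
    by (simp only: refl_line_direction span_direction_eq_iff sin_pi_quotient_eq_0_iff[OF assms])
  then show ?thesis
    by (simp add: cong_int_iff[symmetric] cong_iff_dvd_diff)
qed

lemma refl_line_Int:
  assumes "n > 0" "\<not> [i = j] (mod 2 * n)"
  shows "refl_line n i \<inter> refl_line n j = {0}"
proof -
  have "refl_line n i \<noteq> refl_line n j" using assms by (simp only: refl_line_eq_iff simp_thms)
  then show ?thesis
    unfolding refl_line_direction using span_direction_eq_iff span_direction_Int by blast
qed

text \<open>There are at least four lines, and two distinct ones meet only in the origin, which lies
  on any third. Hence the reduction relation is available for distinct indices as soon as R(i,j) is
  nonempty.\<close>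

lemma not_only_two_lines:
  assumes "n \<ge> 2" "i < 2 * n" "j < 2 * n" "i \<noteq> j"
  shows "\<not> only_two_lines n i j"
proof -
  obtain k where k: "k < 2 * n" "k \<noteq> i" "k \<noteq> j"
  proof -
    have "card {i, j} < card {..<2 * n}" using assms by (auto simp: card_insert_if)
    then have "\<not> {..<2 * n} \<subseteq> {i, j}" using card_mono[of "{i, j}" "{..<2 * n}"] by auto
    then show thesis using that by auto
  qed
  have "refl_line n i \<inter> refl_line n j \<subseteq> refl_line n k"
    using refl_line_Int[of n i j] assms by (simp add: cong_def refl_line_def span_zero)
  moreover have "refl_line n k \<noteq> refl_line n i" "refl_line n k \<noteq> refl_line n j"
    using assms k by (simp_all add: refl_line_eq_iff cong_def)
  ultimately show ?thesis using k unfolding only_two_lines_def by blast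
qed

section \<open>Index arithmetic modulo 2n and the sets R(i,j)\<close>

lemma dih_refl_mod:
  assumes "n > 0"
  shows "dih_refl n (i mod (2 * n)) = dih_refl n i"
  using assms by (simp add: dih_refl_eq_iff)

lemma reflections_eq_range:
  assumes "n > 0"
  shows "reflections n = range (dih_refl n)"
proof -
  have "dih_refl n i \<in> dih_refl n ` {0..<2 * n}" for i
    by (rule image_eqI[of _ _ "i mod (2 * n)"]) (use assms in \<open>simp_all add: dih_refl_mod\<close>)
  then show ?thesis by (auto simp: reflections_def)
qed

lemma mem_R_set_iff:
  assumes "n > 0"
  shows "s \<in> R_set n i j \<longleftrightarrow> (\<exists>a. s = dih_refl n a \<and> [i + j = 2 * a] (mod 2 * n))"
  unfolding R_set_def reflections_eq_range[OF assms]
  using dih_refl_image_refl_line_iff[OF assms] by blast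

lemma dih_refl_involution [simp]: "dih_refl n i \<circ> dih_refl n i = id"
  by (simp add: fun_eq_iff dih_refl_reflect)

lemma bij_dih_refl: "bij (dih_refl n i)"
  by (metis dih_refl_involution o_bij)

text \<open>The conjugate is the reflection in s_i(H_j), whose index is 2i - j modulo 2n.\<close>

lemma dih_refl_conj:
  assumes "n > 0" "[j + k = 2 * i] (mod 2 * n)"
  shows "dih_refl n i \<circ> dih_refl n j \<circ> dih_refl n i = dih_refl n k"
proof -
  obtain m where "int (2 * i) = int (j + k) + 2 * int n * m"
    using assms(2) by (metis cong_iff_lin cong_int_iff of_nat_mult of_nat_numeral)
  then have "2 * real i = real j + real k + 2 * real n * real_of_int m"
    by (simp flip: of_int_eq_iff[where 'a = real])
  then have "2 * (pi * real i / real n) - pi * real j / real n = pi * real k / real n + 2 * pi * m"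
    using assms(1) by (simp add: field_simps)
  then show ?thesis
    unfolding dih_refl_reflect reflect_conj reflect_eq_iff by blast
qed

text \<open>The modulus 2n is even, so parity is well defined on residues and 2a can only be
  congruent to an even sum; conversely half of an even sum serves as a.\<close>

lemma R_set_empty_iff:
  assumes "n > 0"
  shows "R_set n i j = {} \<longleftrightarrow> odd (i + j)"
proof -
  have "even (i + j) \<longleftrightarrow> (\<exists>a. [i + j = 2 * a] (mod 2 * n))"
  proof
    show "\<exists>a. [i + j = 2 * a] (mod 2 * n)" if "even (i + j)"
      using that by (metis cong_refl evenE)
    show "even (i + j)" if "\<exists>a. [i + j = 2 * a] (mod 2 * n)"
      using that by (metis cong_dvd_iff cong_dvd_modulus_nat dvd_triv_left)
  qed
  then show ?thesis using mem_R_set_iff[OF assms] by blast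
qed

text \<open>Halving leaves a congruence modulo n, and one class modulo n splits into two modulo 2n;
  the parity of the quotient \<open>k\<close> decides between them.\<close>

lemma cong_double_modulus_iff:
  fixes a b n :: nat
  shows "[2 * a = 2 * b] (mod 2 * n) \<longleftrightarrow> [b = a] (mod 2 * n) \<or> [b = a + n] (mod 2 * n)"
proof -
  have "2 * int n dvd 2 * int a - 2 * int b
      \<longleftrightarrow> 2 * int n dvd int b - int a \<or> 2 * int n dvd int b - (int a + int n)"
  proof
    assume "2 * int n dvd 2 * int a - 2 * int b"
    then obtain k where "2 * int a - 2 * int b = 2 * int n * k" by blast
    then have k: "int b - int a = int n * (- k)" by simp
    show "2 * int n dvd int b - int a \<or> 2 * int n dvd int b - (int a + int n)"
    proof (cases "even k")
      case True
      then obtain l where "- k = 2 * l" by (metis dvd_def dvd_minus_iff)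
      with k have "int b - int a = 2 * int n * l" by simp
      then show ?thesis by (metis dvd_triv_left)
    next
      case False
      then obtain l where "- k = 2 * l + 1" by (metis even_minus oddE)
      with k have "int b - (int a + int n) = 2 * int n * l" by (simp add: algebra_simps)
      then show ?thesis by (metis dvd_triv_left)
    qed
  next
    assume "2 * int n dvd int b - int a \<or> 2 * int n dvd int b - (int a + int n)"
    then consider k where "int b - int a = 2 * int n * k"
      | k where "int b - (int a + int n) = 2 * int n * k"
      by (auto simp: dvd_def)
    then show "2 * int n dvd 2 * int a - 2 * int b"
    proof cases
      case 1
      then have "2 * int a - 2 * int b = 2 * int n * (- 2 * k)" by (simp add: algebra_simps)
      then show ?thesis by (metis dvd_triv_left)
    next
      case 2
      then have "2 * int a - 2 * int b = 2 * int n * (- 2 * k - 1)" by (simp add: algebra_simps)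
      then show ?thesis by (metis dvd_triv_left)
    qed
  qed
  then show ?thesis
    by (simp add: cong_int_iff[symmetric] cong_iff_dvd_diff)
qed

text \<open>The mirrors exchanging two lines are their two angle bisectors. These are perpendicular,
  so their indices differ by n.\<close>

lemma R_set_eq_pair:
  assumes "n > 0" "[i + j = 2 * a] (mod 2 * n)"
  shows "R_set n i j = {dih_refl n a, dih_refl n (a + n)}"
proof -
  have "[i + j = 2 * b] (mod 2 * n)
      \<longleftrightarrow> dih_refl n b = dih_refl n a \<or> dih_refl n b = dih_refl n (a + n)" for b
    using assms cong_double_modulus_iff[of a b n] by (simp add: dih_refl_eq_iff cong_def)
  then show ?thesis by (auto simp: mem_R_set_iff[OF assms(1)])
qed

section \<open>Membership in the dihedral group\<close>

lemma dih_refl_in_dihedral: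
  assumes "n > 0"
  shows "dih_refl n i \<in> dihedral n"
  unfolding dihedral_def by (rule generate.incl) (simp add: assms reflections_eq_range)

lemma id_in_dihedral: "id \<in> dihedral n"
  using generate.one[of "BijGroup UNIV" "reflections n"]
  by (simp add: dihedral_def BijGroup_def id_def restrict_UNIV)

text \<open>The product of \<open>BijGroup\<close> is composition only on its carrier, so
  bijectivity is what identifies it with the plain composition used in the relations.\<close>

lemma bij_dihedral:
  assumes "w \<in> dihedral n"
  shows "bij w"
proof -
  interpret group "BijGroup (UNIV :: (real^2) set)" by (rule group_BijGroup)
  have "reflections n \<subseteq> carrier (BijGroup UNIV)"
    by (auto simp: reflections_def BijGroup_def Bij_def bij_dih_refl)
  then have "w \<in> carrier (BijGroup UNIV)"
    using assms generate_in_carrier unfolding dihedral_def by blast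
  then show ?thesis by (simp add: BijGroup_def Bij_def)
qed

lemma comp_in_dihedral:
  assumes "u \<in> dihedral n" "v \<in> dihedral n"
  shows "u \<circ> v \<in> dihedral n"
proof -
  have "u \<otimes>\<^bsub>BijGroup UNIV\<^esub> v = u \<circ> v"
    using assms[THEN bij_dihedral] by (simp add: BijGroup_def Bij_def compose_def comp_def restrict_UNIV)
  then show ?thesis
    using assms generate.eng unfolding dihedral_def by metis
qed

lemma dih_refl_commute:
  assumes "n > 0" "[j + j = 2 * i] (mod 2 * n)"
  shows "dih_refl n i \<circ> dih_refl n j = dih_refl n j \<circ> dih_refl n i"
proof -
  \<comment> \<open>The first factor of the inserted square completes the conjugate s_i s_j s_i,
    which the hypothesis makes equal to s_j.\<close>
  have "dih_refl n i \<circ> dih_refl n j = dih_refl n i \<circ> dih_refl n j \<circ> (dih_refl n i \<circ> dih_refl n i)"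
    by simp
  also have "\<dots> = dih_refl n j \<circ> dih_refl n i"
    unfolding comp_assoc[symmetric] dih_refl_conj[OF assms] ..
  finally show ?thesis .
qed

lemma cong_add_solvable:
  fixes a b n :: nat
  assumes "n > 0"
  shows "\<exists>l. [a + l = b] (mod 2 * n)"
proof
  \<comment> \<open>Modulo 2n the term \<open>(2 * n - 1) * a\<close> is -a, so the witness stands
    for b - a.\<close>
  have eq: "a + (b + (2 * n - 1) * a) = b + 2 * n * a"
    using assms by (cases n) (simp_all add: algebra_simps)
  then show "[a + (b + (2 * n - 1) * a) = b] (mod 2 * n)"
    unfolding cong_def eq by simp
qed

section \<open>The free algebra modulo the Brauer relations\<close>

definition scalar :: "complex \<Rightarrow> free_elt" where
  "scalar c = Poly_Mapping.single [] c"

lemma scalar_1: "scalar 1 = 1"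
  by (simp add: scalar_def zero_list_def[symmetric])

lemma scalar_mult: "scalar a * scalar b = scalar (a * b)"
  by (simp add: scalar_def mult_single plus_list_def)

lemma scalar_diff: "scalar a - scalar b = scalar (a - b)"
  by (simp add: scalar_def single_diff)

lemma scalar_central: "p * scalar c = scalar c * p"
proof (induction p rule: update_induct)
  case const
  show ?case by simp
next
  case (update p w z)
  \<comment> \<open>The word \<open>w\<close> is not yet a key of \<open>p\<close>, so updating
    amounts to adding one monomial; on a monomial the empty word commutes.\<close>
  have "Poly_Mapping.update w z p = p + Poly_Mapping.single w z"
    using update(1) by (intro poly_mapping_eqI)
      (auto simp: lookup_update lookup_add lookup_single when_def in_keys_iff)
  moreover have "Poly_Mapping.single w z * scalar c = scalar c * Poly_Mapping.single w z"
    by (simp add: scalar_def mult_single plus_list_def mult.commute)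
  ultimately show ?case by (simp add: update(3) distrib_left distrib_right)
qed

section \<open>Closure properties of the carrier of the free algebra\<close>

lemma mem_carrier_free_algebra: "p \<in> carrier (free_algebra X) \<longleftrightarrow> Poly_Mapping.keys p \<subseteq> lists X"
  by (simp add: free_algebra_def)

lemma scalar_closed: "scalar c \<in> carrier (free_algebra (gens n))"
  by (simp add: mem_carrier_free_algebra scalar_def)

lemma fw_closed: "w \<in> dihedral n \<Longrightarrow> fw w \<in> carrier (free_algebra (gens n))"
  by (simp add: mem_carrier_free_algebra fw_def gens_def)

lemma fe_closed: "i < 2 * n \<Longrightarrow> fe i \<in> carrier (free_algebra (gens n))"
  by (simp add: mem_carrier_free_algebra fe_def gens_def)

lemma one_closed: "1 \<in> carrier (free_algebra X)"
  using ring.ring_simprules(6)[OF ring_free_algebra[of X]] by (simp add: free_algebra_def)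

lemma mult_closed:
  "p \<in> carrier (free_algebra X) \<Longrightarrow> q \<in> carrier (free_algebra X) \<Longrightarrow> p * q \<in> carrier (free_algebra X)"
  using ring.ring_simprules(5)[OF ring_free_algebra[of X]] by (simp add: free_algebra_def)

lemma add_closed:
  "p \<in> carrier (free_algebra X) \<Longrightarrow> q \<in> carrier (free_algebra X) \<Longrightarrow> p + q \<in> carrier (free_algebra X)"
  using ring.ring_simprules(1)[OF ring_free_algebra[of X]] by (simp add: free_algebra_def)

lemma diff_closed:
  assumes "p \<in> carrier (free_algebra X)" "q \<in> carrier (free_algebra X)"
  shows "p - q \<in> carrier (free_algebra X)"
proof -
  have "Poly_Mapping.keys (p - q) \<subseteq> Poly_Mapping.keys p \<union> Poly_Mapping.keys q"
    by (auto simp: in_keys_iff lookup_minus)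
  then show ?thesis using assms unfolding mem_carrier_free_algebra by blast
qed

lemma sum_closed:
  "(\<And>s. s \<in> A \<Longrightarrow> f s \<in> carrier (free_algebra X)) \<Longrightarrow> sum f A \<in> carrier (free_algebra X)"
proof (induction A rule: infinite_finite_induct)
  case (insert s A)
  then show ?case by (simp add: add_closed)
qed (simp_all add: mem_carrier_free_algebra)

lemmas free_algebra_closed =
  scalar_closed fw_closed fe_closed one_closed mult_closed add_closed diff_closed sum_closed

section \<open>Congruence modulo the Brauer ideal\<close>

locale dihedral_brauer =
  fixes n :: nat and \<mu> :: "(real^2 \<Rightarrow> real^2) \<Rightarrow> complex" and \<tau> :: "nat \<Rightarrow> complex"
  assumes n_ge_2: "n \<ge> 2"
begin

lemma n_pos: "n > 0"
  using n_ge_2 by simp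

abbreviation "carr \<equiv> carrier (free_algebra (gens n))"

text \<open>The library facts that the generated set is an ideal and contains its generators require
  the generators to lie in the carrier.\<close>

lemma brauer_rel_closed:
  assumes "brauer_rel n \<mu> \<tau> x y"
  shows "x - y \<in> carr"
proof -
  have refl: "dih_refl n i \<in> dihedral n" for i
    using n_pos by (rule dih_refl_in_dihedral)
  have R: "s \<in> dihedral n" if "s \<in> R_set n i j" for s i j
    using that n_pos by (auto simp: mem_R_set_iff dih_refl_in_dihedral)
  from assms show ?thesis
    by cases (auto simp: scalar_def[symmetric] id_in_dihedral refl R intro!: free_algebra_closed)
qed

lemma ideal_brauer_ideal: "ideal (brauer_ideal n \<mu> \<tau>) (free_algebra (gens n))"
  unfolding brauer_ideal_def
  by (rule ring.genideal_ideal[OF ring_free_algebra]) (auto simp: brauer_rel_closed)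

text \<open>Equality in the quotient is handled as a congruence between representatives, so that
  computations are chains of free algebra elements. The ideal absorbs factors from the carrier,
  whence the side conditions \<open>c \<in> carr\<close> in the multiplication rules.\<close>

definition equiv_mod :: "free_elt \<Rightarrow> free_elt \<Rightarrow> bool" (infix "\<doteq>" 50) where
  "x \<doteq> y \<longleftrightarrow> x - y \<in> brauer_ideal n \<mu> \<tau>"

lemma equiv_rel: "brauer_rel n \<mu> \<tau> x y \<Longrightarrow> x \<doteq> y"
proof -
  assume "brauer_rel n \<mu> \<tau> x y"
  then have "x - y \<in> {x - y | x y. brauer_rel n \<mu> \<tau> x y}" by blast
  moreover have "{x - y | x y. brauer_rel n \<mu> \<tau> x y} \<subseteq> carr"
    by (auto simp: brauer_rel_closed)
  ultimately show ?thesis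
    unfolding equiv_mod_def brauer_ideal_def using ring.genideal_self[OF ring_free_algebra] by blast
qed

lemma ideal_mult_left: "x \<in> brauer_ideal n \<mu> \<tau> \<Longrightarrow> c \<in> carr \<Longrightarrow> c * x \<in> brauer_ideal n \<mu> \<tau>"
  using ideal.I_l_closed[OF ideal_brauer_ideal] by (simp add: free_algebra_def)

lemma ideal_mult_right: "x \<in> brauer_ideal n \<mu> \<tau> \<Longrightarrow> c \<in> carr \<Longrightarrow> x * c \<in> brauer_ideal n \<mu> \<tau>"
  using ideal.I_r_closed[OF ideal_brauer_ideal] by (simp add: free_algebra_def)

lemma ideal_add:
  "x \<in> brauer_ideal n \<mu> \<tau> \<Longrightarrow> y \<in> brauer_ideal n \<mu> \<tau> \<Longrightarrow> x + y \<in> brauer_ideal n \<mu> \<tau>"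
  using additive_subgroup.a_closed[OF ideal.axioms(1)[OF ideal_brauer_ideal]]
  by (simp add: free_algebra_def)

lemma ideal_zero: "0 \<in> brauer_ideal n \<mu> \<tau>"
  using additive_subgroup.zero_closed[OF ideal.axioms(1)[OF ideal_brauer_ideal]]
  by (simp add: free_algebra_def)

lemma ideal_uminus: "x \<in> brauer_ideal n \<mu> \<tau> \<Longrightarrow> - x \<in> brauer_ideal n \<mu> \<tau>"
proof -
  assume x: "x \<in> brauer_ideal n \<mu> \<tau>"
  have "scalar (- 1) = - scalar 1" by (simp add: scalar_def single_uminus)
  then have "scalar (- 1) * x = - x" by (simp add: scalar_1)
  then show ?thesis using ideal_mult_left[OF x scalar_closed] by metis
qed

lemma equiv_refl [simp]: "x \<doteq> x"
  by (simp add: equiv_mod_def ideal_zero)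

lemma equiv_sym: "x \<doteq> y \<Longrightarrow> y \<doteq> x"
  using ideal_uminus[of "x - y"] by (simp add: equiv_mod_def)

lemma equiv_trans [trans]: "x \<doteq> y \<Longrightarrow> y \<doteq> z \<Longrightarrow> x \<doteq> z"
  using ideal_add[of "x - y" "y - z"] by (simp add: equiv_mod_def)

lemma equiv_add: "x \<doteq> y \<Longrightarrow> u \<doteq> v \<Longrightarrow> x + u \<doteq> y + v"
  using ideal_add[of "x - y" "u - v"] by (simp add: equiv_mod_def add_diff_add)

lemma equiv_diff: "x \<doteq> y \<Longrightarrow> u \<doteq> v \<Longrightarrow> x - u \<doteq> y - v"
  using ideal_add[of "x - y" "- (u - v)"] ideal_uminus[of "u - v"]
  by (simp add: equiv_mod_def algebra_simps)

lemma equiv_mult_left: "x \<doteq> y \<Longrightarrow> c \<in> carr \<Longrightarrow> c * x \<doteq> c * y"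
  using ideal_mult_left[of "x - y" c] by (simp add: equiv_mod_def right_diff_distrib)

lemma equiv_mult_right: "x \<doteq> y \<Longrightarrow> c \<in> carr \<Longrightarrow> x * c \<doteq> y * c"
  using ideal_mult_right[of "x - y" c] by (simp add: equiv_mod_def left_diff_distrib)

text \<open>Generators are indexed by all natural numbers, periodically, so that index arithmetic modulo
  \<open>2 * n\<close> becomes a congruence.\<close>

definition S :: "nat \<Rightarrow> free_elt" where "S i = fw (dih_refl n i)"

definition E :: "nat \<Rightarrow> free_elt" where "E i = fe (i mod (2 * n))"

abbreviation m :: "nat \<Rightarrow> complex" where "m i \<equiv> \<mu> (dih_refl n i)"

abbreviation t :: "nat \<Rightarrow> complex" where "t i \<equiv> \<tau> (i mod (2 * n))"

section \<open>The defining relations with periodic indices\<close>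

lemma S_closed [simp]: "S i \<in> carr"
  by (simp add: S_def fw_closed dih_refl_in_dihedral n_pos)

lemma E_closed [simp]: "E i \<in> carr"
  by (simp add: E_def fe_closed n_pos)

lemma E_cong: "[i = j] (mod 2 * n) \<Longrightarrow> E i = E j"
  by (simp add: E_def cong_def)

lemma fw_mult: "u \<in> dihedral n \<Longrightarrow> v \<in> dihedral n \<Longrightarrow> fw u * fw v \<doteq> fw (u \<circ> v)"
  by (intro equiv_rel rel_group comp_in_dihedral) simp_all

lemma S_S: "S i * S i \<doteq> 1"
proof -
  have "S i * S i \<doteq> fw id"
    using fw_mult[of "dih_refl n i" "dih_refl n i"] by (simp add: S_def dih_refl_in_dihedral n_pos)
  also have "fw id \<doteq> 1" by (rule equiv_rel) (rule rel_unit)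
  finally show ?thesis .
qed

lemma S_S_S:
  assumes "[j + l = 2 * i] (mod 2 * n)"
  shows "S i * S j * S i \<doteq> S l"
proof -
  have d: "dih_refl n a \<in> dihedral n" for a
    by (simp add: dih_refl_in_dihedral n_pos)
  have "S i * S j * S i \<doteq> fw (dih_refl n i \<circ> dih_refl n j) * S i"
    unfolding S_def by (intro equiv_mult_right fw_mult fw_closed d)
  also have "\<dots> \<doteq> fw (dih_refl n i \<circ> dih_refl n j \<circ> dih_refl n i)"
    unfolding S_def by (intro fw_mult comp_in_dihedral d)
  also have "\<dots> = S l"
    unfolding S_def by (simp only: dih_refl_conj[OF n_pos assms])
  finally show ?thesis .
qed

lemma S_E: "S i * E i \<doteq> E i"
  using equiv_rel[OF rel_refl_left[of "i mod (2 * n)"]] n_pos by (simp add: S_def E_def dih_refl_mod)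

lemma E_E: "E i * E i \<doteq> scalar (t i) * E i"
  using equiv_rel[OF rel_square[of "i mod (2 * n)"]] n_pos by (simp add: E_def scalar_def)

lemma S_conj_E:
  assumes "[j + l = 2 * a] (mod 2 * n)"
  shows "S a * E j \<doteq> E l * S a"
proof -
  have "[l mod (2 * n) + j mod (2 * n) = 2 * a] (mod 2 * n)"
    using assms by (simp add: cong_def mod_simps add.commute)
  then have "dih_refl n a ` refl_line n (j mod (2 * n)) = refl_line n (l mod (2 * n))"
    by (simp add: dih_refl_image_refl_line_iff n_pos)
  then show ?thesis
    unfolding S_def E_def using n_pos by (intro equiv_rel rel_conj) (simp_all add: dih_refl_in_dihedral)
qed

text \<open>Odd i + j forces distinct residues and an empty R(i,j), so whichever case of
  \<open>only_two_lines\<close> holds, the relation is a commutation.\<close>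

lemma E_commute:
  assumes "odd (i + j)"
  shows "E i * E j \<doteq> E j * E i"
proof -
  let ?i = "i mod (2 * n)" and ?j = "j mod (2 * n)"
  have "odd (?i + ?j)" using assms by (simp add: even_mod_2_iff mod_mod_cancel parity_cases dvd_mod_iff)
  then have "R_set n ?i ?j = {}" "?i \<noteq> ?j"
    using n_pos by (auto simp: R_set_empty_iff)
  then have "brauer_rel n \<mu> \<tau> (fe ?i * fe ?j) (fe ?j * fe ?i)"
    using n_pos by (cases "only_two_lines n ?i ?j") (simp_all add: rel_comm_two rel_comm_empty)
  then show ?thesis unfolding E_def by (rule equiv_rel)
qed

lemma E_reduce:
  assumes "[j + l = 2 * a] (mod 2 * n)" "\<not> [j = l] (mod 2 * n)"
  shows "E j * E l \<doteq> (scalar (m a) * S a + scalar (m (a + n)) * S (a + n)) * E l"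
proof -
  let ?j = "j mod (2 * n)" and ?l = "l mod (2 * n)"
  have "[?j + ?l = 2 * a] (mod 2 * n)"
    using assms by (simp add: cong_def mod_simps)
  then have R: "R_set n ?j ?l = {dih_refl n a, dih_refl n (a + n)}"
    by (rule R_set_eq_pair[OF n_pos])
  \<comment> \<open>The sum in the relation runs over a set; it has two terms because the two
    reflections differ.\<close>
  have "\<not> [a = a + n] (mod 2 * n)"
    using n_pos cong_add_lcancel_nat[of a 0 n "2 * n"] by (simp add: cong_def)
  then have ne: "dih_refl n a \<noteq> dih_refl n (a + n)" by (simp add: dih_refl_eq_iff n_pos)
  have "E j * E l \<doteq> (\<Sum>s\<in>R_set n ?j ?l. Poly_Mapping.single [] (\<mu> s) * fw s) * fe ?l"
    unfolding E_def
  proof (rule equiv_rel, rule rel_reduce)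
    show "?j \<noteq> ?l" using assms(2) by (simp add: cong_def)
    then show "\<not> only_two_lines n ?j ?l" using not_only_two_lines n_ge_2 by simp
    show "R_set n ?j ?l \<noteq> {}" by (simp add: R)
  qed (use n_pos in simp_all)
  then show ?thesis using ne by (simp add: R scalar_def S_def E_def)
qed

subsection \<open>Vanishing of products of opposite parity\<close>

lemma scalar_cancel:
  assumes "scalar c * x \<doteq> 0" "c \<noteq> 0"
  shows "x \<doteq> 0"
proof -
  have "scalar (1 / c) * (scalar c * x) \<doteq> scalar (1 / c) * 0"
    using assms(1) scalar_closed by (rule equiv_mult_left)
  then show ?thesis using assms(2) by (simp add: mult.assoc[symmetric] scalar_mult scalar_1)
qed

text \<open>Eliminating \<open>y\<close> leaves (p^2 - q^2) \<open>x\<close>; the last two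
  hypotheses are the factors of this determinant.\<close>

lemma symmetric_system_cancel:
  assumes "scalar p * x + scalar q * y \<doteq> 0" "scalar p * y + scalar q * x \<doteq> 0"
    and "p + q \<noteq> 0" "p - q \<noteq> 0"
  shows "x \<doteq> 0"
proof -
  have "scalar p * (scalar p * x + scalar q * y) - scalar q * (scalar p * y + scalar q * x)
      \<doteq> scalar p * 0 - scalar q * 0"
    using assms(1,2) by (intro equiv_diff equiv_mult_left scalar_closed)
  moreover have "scalar p * (scalar p * x + scalar q * y) - scalar q * (scalar p * y + scalar q * x)
      = scalar ((p + q) * (p - q)) * x"
    by (simp add: distrib_left mult.assoc[symmetric] scalar_mult scalar_diff[symmetric]
        left_diff_distrib square_diff_square_factored[symmetric] mult.commute[of q p])
  ultimately show ?thesis using assms(3,4) scalar_cancel by simp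
qed

text \<open>An s_i inserted on the left is absorbed by e_i. After commuting the two factors it meets
  e_j first, turns it into e_l while passing, and is absorbed by e_i on the other side.\<close>

lemma E_E_transfer:
  assumes "odd (i + j)" "[j + l = 2 * i] (mod 2 * n)"
  shows "E i * E j \<doteq> E l * E i" "S i * (E i * E j) \<doteq> E i * E j"
proof -
  have SE: "S i * E i * E j \<doteq> E i * E j"
    by (intro equiv_mult_right S_E E_closed)
  then show S: "S i * (E i * E j) \<doteq> E i * E j" by (simp add: mult.assoc)
  have "E i * E j \<doteq> S i * (E i * E j)" using S by (rule equiv_sym)
  also have "\<dots> \<doteq> S i * (E j * E i)"
    using assms(1) by (intro equiv_mult_left E_commute S_closed)
  also have "\<dots> = S i * E j * E i" by (simp add: mult.assoc)
  also have "\<dots> \<doteq> E l * S i * E i"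
    using assms(2) by (intro equiv_mult_right S_conj_E E_closed)
  also have "\<dots> = E l * (S i * E i)" by (simp add: mult.assoc)
  also have "\<dots> \<doteq> E l * E i" by (intro equiv_mult_left S_E E_closed)
  finally show "E i * E j \<doteq> E l * E i" .
qed

text \<open>Evaluates \<open>e\<^sub>j e\<^sub>l e\<^sub>i\<close> in two ways: as \<open>e\<^sub>j\<^sup>2 e\<^sub>i\<close> and by reducing \<open>e\<^sub>j e\<^sub>l\<close>.\<close>

lemma E_E_eigen:
  assumes "odd (i + j)" "[j + l = 2 * i] (mod 2 * n)" "\<not> [j = l] (mod 2 * n)"
  shows "scalar (m i - t j) * (E i * E j) + scalar (m (i + n)) * (S (i + n) * (E i * E j)) \<doteq> 0"
proof -
  define X where "X = E i * E j"
  have X: "X \<doteq> E j * E i" "X \<doteq> E l * E i" "S i * X \<doteq> X"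
    unfolding X_def using assms by (auto intro: E_commute E_E_transfer)
  have "scalar (m i) * X + scalar (m (i + n)) * (S (i + n) * X)
      \<doteq> scalar (m i) * (S i * X) + scalar (m (i + n)) * (S (i + n) * X)"
    by (intro equiv_add equiv_mult_left scalar_closed equiv_refl equiv_sym[OF X(3)])
  also have "\<dots> = (scalar (m i) * S i + scalar (m (i + n)) * S (i + n)) * X"
    by (simp add: distrib_right mult.assoc)
  also have "\<dots> \<doteq> (scalar (m i) * S i + scalar (m (i + n)) * S (i + n)) * (E l * E i)"
    by (intro equiv_mult_left X(2) add_closed mult_closed scalar_closed S_closed)
  also have "\<dots> = (scalar (m i) * S i + scalar (m (i + n)) * S (i + n)) * E l * E i"
    by (simp add: mult.assoc)
  also have "\<dots> \<doteq> E j * E l * E i"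
    using assms(2,3) by (intro equiv_mult_right equiv_sym[OF E_reduce] E_closed)
  also have "\<dots> = E j * (E l * E i)" by (simp add: mult.assoc)
  also have "\<dots> \<doteq> E j * X" by (intro equiv_mult_left equiv_sym[OF X(2)] E_closed)
  also have "\<dots> \<doteq> E j * (E j * E i)" by (intro equiv_mult_left X(1) E_closed)
  also have "\<dots> = E j * E j * E i" by (simp add: mult.assoc)
  also have "\<dots> \<doteq> scalar (t j) * E j * E i" by (intro equiv_mult_right E_E E_closed)
  also have "\<dots> = scalar (t j) * (E j * E i)" by (simp add: mult.assoc)
  also have "\<dots> \<doteq> scalar (t j) * X" by (intro equiv_mult_left equiv_sym[OF X(1)] scalar_closed)
  finally have "scalar (m i) * X + scalar (m (i + n)) * (S (i + n) * X) - scalar (t j) * X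
      \<doteq> scalar (t j) * X - scalar (t j) * X"
    by (rule equiv_diff) simp
  then show ?thesis
    unfolding X_def[symmetric] by (simp add: scalar_diff[symmetric] left_diff_distrib diff_add_eq)
qed

lemma S_cancel: "S i * (S i * x) \<doteq> x" if "x \<in> carr" for x
proof -
  have "S i * S i * x \<doteq> 1 * x" using that by (intro equiv_mult_right S_S)
  then show ?thesis by (simp add: mult.assoc)
qed

lemma mult_scalar_left: "x * (scalar c * y) = scalar c * (x * y)"
  by (metis mult.assoc scalar_central)

lemma E_E_zero_of_noncommuting:
  assumes "odd (i + j)" "\<not> [2 * j = 2 * i] (mod 2 * n)"
    and "m i + m (i + n) - t j \<noteq> 0" "m i - m (i + n) - t j \<noteq> 0"
  shows "E i * E j \<doteq> 0"
proof -
  obtain l where l: "[j + l = 2 * i] (mod 2 * n)"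
    using cong_add_solvable[OF n_pos] by blast
  \<comment> \<open>The reduction relation for e_j e_l needs distinct indices; j = l would make 2j
    and 2i congruent.\<close>
  have jl: "\<not> [j = l] (mod 2 * n)"
  proof
    assume "[j = l] (mod 2 * n)"
    then have "[j + j = j + l] (mod 2 * n)" by (intro cong_add cong_refl)
    with l have "[2 * j = 2 * i] (mod 2 * n)" by (metis cong_trans mult_2)
    with assms(2) show False by contradiction
  qed
  define X where "X = E i * E j"
  have Xc: "X \<in> carr" unfolding X_def by (intro mult_closed E_closed)
  have 1: "scalar (m i - t j) * X + scalar (m (i + n)) * (S (i + n) * X) \<doteq> 0"
    unfolding X_def using assms(1) l jl by (rule E_E_eigen)
  \<comment> \<open>Multiplying the first equation by the involution s_(i+n) exchanges
    \<open>X\<close> and its image, which gives the second equation of the system.\<close>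
  have "scalar (m i - t j) * (S (i + n) * X) + scalar (m (i + n)) * X
      \<doteq> scalar (m i - t j) * (S (i + n) * X) + scalar (m (i + n)) * (S (i + n) * (S (i + n) * X))"
    by (intro equiv_add equiv_refl equiv_mult_left scalar_closed equiv_sym[OF S_cancel] Xc)
  also have "\<dots> = S (i + n) * (scalar (m i - t j) * X + scalar (m (i + n)) * (S (i + n) * X))"
    by (simp only: distrib_left mult_scalar_left)
  also have "\<dots> \<doteq> S (i + n) * 0"
    using 1 by (intro equiv_mult_left S_closed)
  finally have 2: "scalar (m i - t j) * (S (i + n) * X) + scalar (m (i + n)) * X \<doteq> 0" by simp
  show ?thesis
    unfolding X_def[symmetric] using 1 2
    by (rule symmetric_system_cancel) (use assms(3,4) in \<open>simp_all add: algebra_simps\<close>)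
qed

lemma adjacent_E_fixed: "S a * (E 1 * E 0) \<doteq> E 1 * E 0"
proof -
  define Y where "Y = E 1 * E 0"
  have Yc: "Y \<in> carr" unfolding Y_def by (intro mult_closed E_closed)
  have S1: "S 1 * Y \<doteq> Y"
    unfolding Y_def by (rule E_E_transfer[of _ _ 2]) (simp_all add: numeral_2_eq_2)
  have comm: "Y \<doteq> E 0 * E 1" unfolding Y_def by (rule E_commute) simp
  have "S 0 * Y \<doteq> S 0 * (E 0 * E 1)" by (intro equiv_mult_left comm S_closed)
  also have "\<dots> \<doteq> E 0 * E 1"
    \<comment> \<open>The index 2n - 1 represents 2 * 0 - 1 modulo 2n.\<close>
    by (rule E_E_transfer[of _ _ "2 * n - 1"]) (use n_pos in \<open>simp_all add: cong_def\<close>)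
  also have "\<dots> \<doteq> Y" using comm by (rule equiv_sym)
  finally have S0: "S 0 * Y \<doteq> Y" .
  \<comment> \<open>Two consecutive reflections are carried along because s_(a+2) = s_(a+1) s_a
    s_(a+1).\<close>
  have "S a * Y \<doteq> Y \<and> S (Suc a) * Y \<doteq> Y"
  proof (induction a)
    case 0
    show ?case using S0 S1 by simp
  next
    case (Suc a)
    have "S (Suc (Suc a)) * Y \<doteq> S (Suc a) * S a * S (Suc a) * Y"
      by (intro equiv_mult_right equiv_sym[OF S_S_S] Yc) (simp add: mult_2)
    also have "\<dots> = S (Suc a) * (S a * (S (Suc a) * Y))" by (simp add: mult.assoc)
    also have "\<dots> \<doteq> S (Suc a) * (S a * Y)" using Suc by (intro equiv_mult_left S_closed) simp
    also have "\<dots> \<doteq> S (Suc a) * Y" using Suc by (intro equiv_mult_left S_closed) simp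
    also have "\<dots> \<doteq> Y" using Suc by simp
    finally show ?case using Suc by simp
  qed
  then show ?thesis by (simp add: Y_def)
qed

text \<open>Every reflection fixes e_1 e_0, so both terms of \<open>E_E_eigen\<close> are multiples
  of it; 2n >= 4 keeps the indices 0 and 2 apart there. Conjugation by s_(i+1) then carries each
  adjacent product to the previous one.\<close>

lemma adjacent_E_zero:
  assumes "m 1 + m (1 + n) - t 0 \<noteq> 0"
  shows "E i * E (Suc i) \<doteq> 0"
proof (induction i)
  case 0
  have "scalar (m 1 + m (1 + n) - t 0) * (E 1 * E 0)
      = scalar (m 1 - t 0) * (E 1 * E 0) + scalar (m (1 + n)) * (E 1 * E 0)"
    by (simp only: distrib_right[symmetric] scalar_def single_add[symmetric]) (simp add: algebra_simps)
  also have "\<dots> \<doteq> scalar (m 1 - t 0) * (E 1 * E 0) + scalar (m (1 + n)) * (S (1 + n) * (E 1 * E 0))"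
    by (intro equiv_add equiv_refl equiv_mult_left scalar_closed equiv_sym[OF adjacent_E_fixed])
  also have "\<dots> \<doteq> 0"
    by (rule E_E_eigen[of _ _ 2]) (use n_ge_2 in \<open>simp_all add: cong_def\<close>)
  finally have "E 1 * E 0 \<doteq> 0" using assms by (rule scalar_cancel)
  then show ?case using equiv_trans[OF E_commute[of 0 1]] by simp
next
  case (Suc i)
  have "E (Suc i) * E (Suc (Suc i)) \<doteq> E i * E (Suc i)"
    by (rule E_E_transfer(1)) (simp_all add: mult_2)
  then show ?case using Suc by (rule equiv_trans)
qed

lemma E_E_zero_of_commuting:
  assumes "odd n"
    and "m 1 + m (1 + n) - t 0 \<noteq> 0"
    and m: "\<And>i. m i + m (i + n) \<noteq> 0" "\<And>i. m i - m (i + n) \<noteq> 0"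
  shows "E (i + n) * E i \<doteq> 0"
proof -
  define X where "X = E (i + n) * E i"
  have Xc: "X \<in> carr" unfolding X_def by (intro mult_closed E_closed)
  obtain h where h: "n = 2 * h + 1" using assms(1) by (rule oddE)
  \<comment> \<open>As n is odd, (i + 1) + (i + n) is even, and this is its half, the index of one
    mirror exchanging H_(i+1) and H_(i+n).\<close>
  define a where "a = i + h + 1"
  have "scalar (m a) * (S a * X) + scalar (m (a + n)) * (S (a + n) * X)
      = (scalar (m a) * S a + scalar (m (a + n)) * S (a + n)) * E (i + n) * E i"
    by (simp add: X_def distrib_right mult.assoc)
  also have "\<dots> \<doteq> E (Suc i) * E (i + n) * E i"
  proof (rule equiv_mult_right[OF equiv_sym[OF E_reduce] E_closed])
    show "[Suc i + (i + n) = 2 * a] (mod 2 * n)" by (simp add: a_def h)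
    show "\<not> [Suc i = i + n] (mod 2 * n)"
      using n_ge_2 cong_add_lcancel_nat[of i 1 n "2 * n"] by (simp add: cong_def)
  qed
  also have "\<dots> = E (Suc i) * (E (i + n) * E i)" by (simp add: mult.assoc)
  also have "\<dots> \<doteq> E (Suc i) * (E i * E (i + n))"
    using assms(1) by (intro equiv_mult_left E_commute E_closed) simp
  also have "\<dots> = E (Suc i) * E i * E (i + n)" by (simp add: mult.assoc)
  also have "\<dots> \<doteq> E i * E (Suc i) * E (i + n)"
    by (intro equiv_mult_right E_commute E_closed) simp
  also have "\<dots> \<doteq> 0 * E (i + n)"
    by (intro equiv_mult_right adjacent_E_zero[OF assms(2)] E_closed)
  finally have 1: "scalar (m a) * (S a * X) + scalar (m (a + n)) * (S (a + n) * X) \<doteq> 0" by simp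
  \<comment> \<open>The mirrors a and a + n are perpendicular, so their reflections commute and
    their product exchanges the two unknowns \<open>S a * X\<close> and
    \<open>S (a + n) * X\<close>.\<close>
  have swap: "S a * S (a + n) * (S a * X) \<doteq> S (a + n) * X"
  proof -
    have "S a * S (a + n) * S a * X \<doteq> S (a + n) * X"
      by (intro equiv_mult_right S_S_S Xc) (simp add: cong_def flip: mult_2)
    then show ?thesis by (simp add: mult.assoc)
  qed
  have "S a * S (a + n) * (S (a + n) * X) = S a * (S (a + n) * (S (a + n) * X))"
    by (simp add: mult.assoc)
  also have "\<dots> \<doteq> S a * X"
    by (intro equiv_mult_left S_cancel S_closed Xc)
  finally have swap': "S a * S (a + n) * (S (a + n) * X) \<doteq> S a * X" .
  have "scalar (m a) * (S (a + n) * X) + scalar (m (a + n)) * (S a * X)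
      \<doteq> scalar (m a) * (S a * S (a + n) * (S a * X)) + scalar (m (a + n)) * (S a * S (a + n) * (S (a + n) * X))"
    by (intro equiv_add equiv_mult_left scalar_closed equiv_sym[OF swap] equiv_sym[OF swap'])
  also have "\<dots> = S a * S (a + n) * (scalar (m a) * (S a * X) + scalar (m (a + n)) * (S (a + n) * X))"
    by (simp only: distrib_left mult_scalar_left)
  also have "\<dots> \<doteq> S a * S (a + n) * 0"
    using 1 by (intro equiv_mult_left mult_closed S_closed)
  finally have 2: "scalar (m a) * (S (a + n) * X) + scalar (m (a + n)) * (S a * X) \<doteq> 0" by simp
  have "S a * X \<doteq> 0"
    using 1 2 m[of a] by (rule symmetric_system_cancel)
  \<comment> \<open>The system kills \<open>S a * X\<close>; the involution recovers
    \<open>X\<close> from it.\<close>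
  then have "S a * (S a * X) \<doteq> S a * 0" by (intro equiv_mult_left S_closed)
  then have "X \<doteq> 0" using equiv_trans[OF equiv_sym[OF S_cancel[OF Xc]]] by simp
  then show ?thesis by (simp add: X_def)
qed

section \<open>From the algebra to its representations\<close>

lemma representation_E_E_zero:
  fixes scl :: "complex \<Rightarrow> 'v \<Rightarrow> 'v::ab_group_add"
  assumes "representation (brauer_algebra n \<mu> \<tau>) scl \<rho>" "i < 2 * n" "j < 2 * n" "E i * E j \<doteq> 0"
  shows "\<rho> (e_elt n \<mu> \<tau> i) \<circ> \<rho> (e_elt n \<mu> \<tau> j) = (\<lambda>_. 0)"
proof -
  let ?F = "free_algebra (gens n)" and ?I = "brauer_ideal n \<mu> \<tau>"
  let ?B = "brauer_algebra n \<mu> \<tau>"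
  interpret F: ring ?F by (rule ring_free_algebra)
  interpret I: ideal ?I ?F by (rule ideal_brauer_ideal)
  \<comment> \<open>The algebra only extends the quotient ring by a scalar action, so the ring
    operations coincide.\<close>
  have B: "carrier ?B = carrier (?F Quot ?I)" "mult ?B = mult (?F Quot ?I)"
      "add ?B = add (?F Quot ?I)" "zero ?B = zero (?F Quot ?I)" "one ?B = one (?F Quot ?I)"
    by (simp_all add: brauer_algebra_def quotient_algebra_def ring.defs module.defs)
  have hom: "\<rho> \<in> ring_hom ?B (End_ring scl)" using assms(1) by (simp add: representation_def)
  have closed: "e_elt n \<mu> \<tau> k \<in> carrier ?B" if "k < 2 * n" for k
    unfolding B e_elt_def FactRing_def using that fe_closed[of k n] by (auto simp: A_RCOSETS_def')
  have zero: "\<zero>\<^bsub>?B\<^esub> = ?I" by (simp add: B FactRing_def)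
  have "fe i * fe j \<in> ?I" using assms(2-4) by (simp add: equiv_mod_def E_def)
  then have "e_elt n \<mu> \<tau> i \<otimes>\<^bsub>?B\<^esub> e_elt n \<mu> \<tau> j = \<zero>\<^bsub>?B\<^esub>"
    unfolding zero using I.rcoset_mult_add[of "fe i" "fe j"] F.a_rcos_zero[OF ideal_brauer_ideal]
      fe_closed assms(2,3)
    by (simp add: B e_elt_def FactRing_def free_algebra_def)
  then have "\<rho> (e_elt n \<mu> \<tau> i) \<circ> \<rho> (e_elt n \<mu> \<tau> j) = \<rho> \<zero>\<^bsub>?B\<^esub>"
    using ring_hom_mult[OF hom closed[OF assms(2)] closed[OF assms(3)]] by (simp add: End_ring_def)
  moreover have "\<rho> \<zero>\<^bsub>?B\<^esub> v = 0" for v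
  proof -
    have "\<zero>\<^bsub>?B\<^esub> \<in> carrier ?B" "\<zero>\<^bsub>?B\<^esub> \<oplus>\<^bsub>?B\<^esub> \<zero>\<^bsub>?B\<^esub> = \<zero>\<^bsub>?B\<^esub>"
      using ring.ring_simprules[OF I.quotient_is_ring] by (simp_all add: B)
    then have "\<rho> \<zero>\<^bsub>?B\<^esub> v = \<rho> \<zero>\<^bsub>?B\<^esub> v + \<rho> \<zero>\<^bsub>?B\<^esub> v"
      using ring_hom_add[OF hom, of "\<zero>\<^bsub>?B\<^esub>" "\<zero>\<^bsub>?B\<^esub>"] by (simp add: End_ring_def fun_eq_iff)
    then show ?thesis by simp
  qed
  ultimately show ?thesis by (simp add: fun_eq_iff)
qed

end

theorem proposition5p4:
  fixes n :: nat
    and \<mu> :: "(real^2 \<Rightarrow> real^2) \<Rightarrow> complex"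
    and \<tau> :: "nat \<Rightarrow> complex"
  assumes "n \<ge> 2"
    and "\<And>i j. i < 2 * n \<Longrightarrow> j < 2 * n \<Longrightarrow> even i = even j \<Longrightarrow> \<mu> (dih_refl n i) = \<mu> (dih_refl n j)"
    and "\<And>i j. i < 2 * n \<Longrightarrow> j < 2 * n \<Longrightarrow> even i = even j \<Longrightarrow> \<tau> i = \<tau> j"
  shows
    "(\<forall>i j k. i < 2 * n \<and> j < 2 * n \<and> k < 2 * n \<and>
        R_set n i j = {} \<and> dih_refl n i \<circ> dih_refl n j \<noteq> dih_refl n j \<circ> dih_refl n i \<and>
        dih_refl n i \<circ> dih_refl n j \<circ> dih_refl n i = dih_refl n k \<and>
        \<mu> (dih_refl n i) + \<mu> (dih_refl n ((n + i) mod (2 * n))) - \<tau> k \<noteq> 0 \<and>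
        \<mu> (dih_refl n i) - \<mu> (dih_refl n ((n + i) mod (2 * n))) - \<tau> k \<noteq> 0 \<longrightarrow>
        (\<forall>(scl :: complex \<Rightarrow> 'v \<Rightarrow> 'v::ab_group_add) \<rho>.
          irreducible_representation (brauer_algebra n \<mu> \<tau>) scl \<rho> \<longrightarrow>
          \<rho> (e_elt n \<mu> \<tau> i) \<circ> \<rho> (e_elt n \<mu> \<tau> j) = (\<lambda>_. 0) \<and>
          \<rho> (e_elt n \<mu> \<tau> j) \<circ> \<rho> (e_elt n \<mu> \<tau> i) = (\<lambda>_. 0)))
   \<and> (\<forall>i j. i < 2 * n \<and> j < 2 * n \<and>
        R_set n i j = {} \<and> dih_refl n i \<circ> dih_refl n j = dih_refl n j \<circ> dih_refl n i \<and>
        \<tau> 0 * (\<mu> (dih_refl n 1) + \<mu> (dih_refl n 0)) \<noteq> 0 \<and>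
        \<tau> 0 * (\<mu> (dih_refl n 1) - \<mu> (dih_refl n 0)) \<noteq> 0 \<and>
        \<mu> (dih_refl n 2) + \<mu> (dih_refl n ((n + 2) mod (2 * n))) - \<tau> (4 mod (2 * n)) \<noteq> 0 \<and>
        \<mu> (dih_refl n 2) - \<mu> (dih_refl n ((n + 2) mod (2 * n))) - \<tau> (4 mod (2 * n)) \<noteq> 0 \<longrightarrow>
        (\<forall>(scl :: complex \<Rightarrow> 'v \<Rightarrow> 'v::ab_group_add) \<rho>.
          irreducible_representation (brauer_algebra n \<mu> \<tau>) scl \<rho> \<longrightarrow>
          \<rho> (e_elt n \<mu> \<tau> i) \<circ> \<rho> (e_elt n \<mu> \<tau> j) = (\<lambda>_. 0) \<and>
          \<rho> (e_elt n \<mu> \<tau> j) \<circ> \<rho> (e_elt n \<mu> \<tau> i) = (\<lambda>_. 0)))"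
proof -
  interpret dihedral_brauer n \<mu> \<tau>
    by standard (rule assms(1))
  have mod_less: "a mod (2 * n) < 2 * n" for a
    using n_pos by simp
  have even_mod: "even (a mod (2 * n)) \<longleftrightarrow> even a" for a
    by (simp add: dvd_mod_iff)
  \<comment> \<open>The parity hypotheses concern indices below 2n. Reduction modulo an even number
    keeps parity, so they extend to all natural indices.\<close>
  have m_eq: "m a = m b" if "even a = even b" for a b
    using assms(2)[OF mod_less mod_less, of a b] that by (simp add: even_mod dih_refl_mod n_pos)
  have t_eq: "t a = t b" if "even a = even b" for a b
    using assms(3)[OF mod_less mod_less, of a b] that by (simp add: even_mod)
  have m_add: "m ((n + a) mod (2 * n)) = m (a + n)" for a
    by (simp add: dih_refl_mod n_pos add.commute)
  have noncommuting: "E i * E j \<doteq> 0"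
    if "i < 2 * n" "j < 2 * n" "k < 2 * n" "R_set n i j = {}"
      "dih_refl n i \<circ> dih_refl n j \<noteq> dih_refl n j \<circ> dih_refl n i"
      "dih_refl n i \<circ> dih_refl n j \<circ> dih_refl n i = dih_refl n k"
      "m i + m ((n + i) mod (2 * n)) - \<tau> k \<noteq> 0" "m i - m ((n + i) mod (2 * n)) - \<tau> k \<noteq> 0"
    for i j k
  proof (rule E_E_zero_of_noncommuting)
    show "odd (i + j)" using that(4) by (simp add: R_set_empty_iff n_pos)
    show "\<not> [2 * j = 2 * i] (mod 2 * n)"
    proof
      assume "[2 * j = 2 * i] (mod 2 * n)"
      then have "[j + j = 2 * i] (mod 2 * n)" by (simp add: mult_2)
      then show False using dih_refl_commute[OF n_pos] that(5) by blast
    qed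
    obtain l where l: "[j + l = 2 * i] (mod 2 * n)" using cong_add_solvable[OF n_pos] by blast
    have "dih_refl n k = dih_refl n l" using that(6) dih_refl_conj[OF n_pos l] by simp
    then have "[k = l] (mod 2 * n)" by (simp add: dih_refl_eq_iff n_pos)
    then have "[j + k = 2 * i] (mod 2 * n)" using l by (metis cong_add_lcancel_nat cong_trans)
    \<comment> \<open>The congruence exhibits a member of R(j,k), so j and k have equal parity and
      \<open>\<tau> k\<close> may replace \<open>t j\<close>.\<close>
    then have "even (j + k)" using R_set_empty_iff[OF n_pos] mem_R_set_iff[OF n_pos] by blast
    then have "t j = \<tau> k" using t_eq[of j k] that(3) by simp
    then show "m i + m (i + n) - t j \<noteq> 0" "m i - m (i + n) - t j \<noteq> 0"
      using that(7,8) by (simp_all add: m_add)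
  qed
  have commuting: "E i * E j \<doteq> 0"
    if "i < 2 * n" "j < 2 * n" "R_set n i j = {}"
      "dih_refl n i \<circ> dih_refl n j = dih_refl n j \<circ> dih_refl n i"
      "\<tau> 0 * (m 1 + m 0) \<noteq> 0" "\<tau> 0 * (m 1 - m 0) \<noteq> 0"
      "m 2 + m ((n + 2) mod (2 * n)) - \<tau> (4 mod (2 * n)) \<noteq> 0"
    for i j
  proof -
    have odd: "odd (i + j)" using that(3) by (simp add: R_set_empty_iff n_pos)
    obtain l where l: "[j + l = 2 * i] (mod 2 * n)" using cong_add_solvable[OF n_pos] by blast
    \<comment> \<open>Commuting reflections satisfy s_i s_j s_i = s_j, so the index l = 2i - j is j
      itself.\<close>
    have "dih_refl n l = dih_refl n j \<circ> (dih_refl n i \<circ> dih_refl n i)"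
      using dih_refl_conj[OF n_pos l] that(4) by (simp add: comp_assoc)
    then have "[j = l] (mod 2 * n)" by (simp add: dih_refl_eq_iff n_pos cong_sym)
    then have "[2 * j = 2 * i] (mod 2 * n)"
      using l by (metis cong_add_lcancel_nat cong_trans mult_2)
    then have "[i = j] (mod 2 * n) \<or> [i = j + n] (mod 2 * n)"
      by (simp only: cong_double_modulus_iff)
    \<comment> \<open>The alternative i = j is excluded because i + j is odd.\<close>
    then have i: "[i = j + n] (mod 2 * n)" using that(1,2) odd by (auto simp: cong_def)
    then have "even i \<longleftrightarrow> even (j + n)" by (metis cong_def even_mod)
    with odd have "odd n" by auto
    have "E (j + n) * E j \<doteq> 0"
    proof (rule E_E_zero_of_commuting[OF \<open>odd n\<close>])
      \<comment> \<open>For odd n the index 1 + n has the parity of 2, and 2 + n that of 1. This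
        turns the hypothesis at the indices 2 and 4 into the one needed at 1 and 0.\<close>
      have "m (1 + n) = m 2" "m 1 = m (2 + n)" using \<open>odd n\<close> by (auto intro!: m_eq)
      moreover have "t 0 = t 4" by (rule t_eq) simp
      moreover have "m 2 + m (2 + n) - t 4 \<noteq> 0" using that(7) unfolding m_add .
      ultimately show "m 1 + m (1 + n) - t 0 \<noteq> 0" by (metis add.commute)
      fix a
      \<comment> \<open>The indices a and a + n have opposite parity, so the required sum and
        difference are, up to sign, those of \<open>m 1\<close> and \<open>m 0\<close>.\<close>
      have "m a = m 0 \<and> m (a + n) = m 1 \<or> m a = m 1 \<and> m (a + n) = m 0"
        using \<open>odd n\<close> m_eq[of a 0] m_eq[of a 1] m_eq[of "a + n" 0] m_eq[of "a + n" 1] by auto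
      then show "m a + m (a + n) \<noteq> 0" "m a - m (a + n) \<noteq> 0"
        using that(5,6) by (auto simp: add.commute)
    qed
    then show ?thesis by (simp only: E_cong[OF i])
  qed
  have swap: "E j * E i \<doteq> 0" if "R_set n i j = {}" "E i * E j \<doteq> 0" for i j
    using that E_commute[of j i] equiv_trans by (simp add: R_set_empty_iff n_pos)
  have products: "\<rho> (e_elt n \<mu> \<tau> i) \<circ> \<rho> (e_elt n \<mu> \<tau> j) = (\<lambda>_. 0) \<and>
      \<rho> (e_elt n \<mu> \<tau> j) \<circ> \<rho> (e_elt n \<mu> \<tau> i) = (\<lambda>_. 0)"
    if "irreducible_representation (brauer_algebra n \<mu> \<tau>) scl \<rho>"
      "i < 2 * n" "j < 2 * n" "R_set n i j = {}" "E i * E j \<doteq> 0"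
    for i j \<rho> and scl :: "complex \<Rightarrow> 'v \<Rightarrow> 'v"
    using that swap[OF that(4,5)] representation_E_E_zero
    unfolding irreducible_representation_def by auto
  show ?thesis
    by (rule conjI; intro allI impI; elim conjE; rule products;
        (assumption | (rule noncommuting; assumption) | (rule commuting; assumption)))
qed

end
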